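(* Let $m,k,n,R$ be positive integers and let $U=(u_{ij}^{(s)})$, $V=(v_{gh}^{(s)})$, $W=(w_{lq}^{(s)})$ be arrays of numbers with $0\le i,l\le m-1$, $0\le j,g\le k-1$, $0\le h,q\le n-1$, $s=1,\dots,R$. Then $U,V,W$ define an elementary program of length $R$ for multiplying an $m\times k$ matrix by a $k\times n$ matrix if and only if the following identity in the indeterminates $a_{ij}$, $b_{gh}$, $d_{ql}$ holds: $$\sum_{s=1}^{R}\Big(\sum_{i,j}u_{ij}^{(s)}a_{ij}\Big)\Big(\sum_{g,h}v_{gh}^{(s)}b_{gh}\Big)\Big(\sum_{l,q}w_{lq}^{(s)}d_{ql}\Big)\equiv\sum_{i,j,h}a_{ij}\,b_{jh}\,d_{hi},$$ where on the right-hand side $0\le i\le m-1$, $0\le j\le k-1$, $0\le h\le n-1$, and the sums on the left-hand side run over the full index ranges given above.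
   Context: The arrays $U,V,W$ are said to define an elementary program of length $R$ for multiplying an $m\times k$ matrix $(a_{ij})$ by a $k\times n$ matrix $(b_{gh})$ if, identically in the $a_{ij}$ and $b_{gh}$, $$\sum_{g=0}^{k-1}a_{lg}b_{gq}\equiv\sum_{s=1}^{R}w_{lq}^{(s)}\Big(\sum_{i=0}^{m-1}\sum_{j=0}^{k-1}u_{ij}^{(s)}a_{ij}\Big)\Big(\sum_{g=0}^{k-1}\sum_{h=0}^{n-1}v_{gh}^{(s)}b_{gh}\Big)$$ for all $l=0,\dots,m-1$ and $q=0,\dots,n-1$. Here $(d_{ql})$ is an auxiliary $n\times m$ matrix of indeterminates. "Numbers" are elements of a fixed field of numbers ($\mathbb{R}$ or $\mathbb{C}$). *)

theory Defs
  imports Complex_Main "HOL-Library.Poly_Mapping"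
begin

text \<open>The indeterminates \<open>a\<^sub>i\<^sub>j\<close>, \<open>b\<^sub>g\<^sub>h\<close> and \<open>d\<^sub>q\<^sub>l\<close>.\<close>

datatype indet = A nat nat | B nat nat | D nat nat

text \<open>
  Polynomials in these (commuting) indeterminates: finitely supported maps from monomials
  (finitely supported exponent functions) to coefficients, with the convolution product.
  Equality in this type is the formal identity of polynomials.
\<close>

type_synonym 'a indet_poly = "(indet \<Rightarrow>\<^sub>0 nat) \<Rightarrow>\<^sub>0 'a"

definition Const :: "'a::zero \<Rightarrow> 'a indet_poly" where
  "Const c = Poly_Mapping.single 0 c"

definition Var :: "indet \<Rightarrow> 'a::zero_neq_one indet_poly" where
  "Var x = Poly_Mapping.single (Poly_Mapping.single x 1) 1"

text \<open>
  An array \<open>U\<close> of the entries \<open>u\<^sub>i\<^sub>j\<^sup>(\<^sup>s\<^sup>)\<close> is the function with \<open>U s i j\<close> that entry; only its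
  values at \<open>1 \<le> s \<le> R\<close> and at matrix indices in range are ever used.  The class
  \<open>real_normed_field\<close> has the instances \<^typ>\<open>real\<close> and \<^typ>\<open>complex\<close>, and up to isomorphism
  these are the only fields in it.
\<close>

definition elementary_program ::
  "nat \<Rightarrow> nat \<Rightarrow> nat \<Rightarrow> nat \<Rightarrow> (nat \<Rightarrow> nat \<Rightarrow> nat \<Rightarrow> 'a::real_normed_field)
    \<Rightarrow> (nat \<Rightarrow> nat \<Rightarrow> nat \<Rightarrow> 'a) \<Rightarrow> (nat \<Rightarrow> nat \<Rightarrow> nat \<Rightarrow> 'a) \<Rightarrow> bool" where
  "elementary_program m k n R U V W \<longleftrightarrow>
    (\<forall>l<m. \<forall>q<n.
      (\<Sum>g<k. Var (A l g) * Var (B g q)) =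
      (\<Sum>s=1..R. Const (W s l q)
        * (\<Sum>i<m. \<Sum>j<k. Const (U s i j) * Var (A i j))
        * (\<Sum>g<k. \<Sum>h<n. Const (V s g h) * Var (B g h))))"

end

theory Submission
  imports Defs
begin

text \<open>
  Multiplying the \<open>(l, q)\<close> identity of an elementary program by \<open>d\<^sub>q\<^sub>l\<close> and summing over \<open>l\<close> and
  \<open>q\<close> gives the trilinear identity.  Conversely, both sides of the trilinear identity are linear
  forms in the \<open>d\<^sub>q\<^sub>l\<close> whose coefficients are polynomials in the \<open>a\<^sub>i\<^sub>j\<close> and \<open>b\<^sub>g\<^sub>h\<close> alone, so these
  coefficients can be compared.
\<close>

text \<open>Keys occur at two levels: those of \<open>p\<close> are its monomials, and those of a
  monomial \<open>t\<close> are the indeterminates that divide it.\<close>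

definition poly_in :: "indet set \<Rightarrow> 'a::zero indet_poly \<Rightarrow> bool" where
  "poly_in X p \<longleftrightarrow> (\<forall>t\<in>Poly_Mapping.keys p. Poly_Mapping.keys t \<subseteq> X)"

lemma poly_in_Const: "poly_in X (Const c)"
  by (simp add: poly_in_def Const_def)

lemma poly_in_Var: "x \<in> X \<Longrightarrow> poly_in X (Var x)"
  by (simp add: poly_in_def Var_def)

lemma poly_in_sum: "(\<And>i. i \<in> I \<Longrightarrow> poly_in X (p i)) \<Longrightarrow> poly_in X (\<Sum>i\<in>I. p i)"
  unfolding poly_in_def using Poly_Mapping.keys_sum[of p I] by blast

lemma poly_in_mult:
  assumes "poly_in X p" and "poly_in X q"
  shows "poly_in X (p * q)"
  unfolding poly_in_def
proof
  fix t assume "t \<in> Poly_Mapping.keys (p * q)"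
  then obtain a b where "t = a + b" "a \<in> Poly_Mapping.keys p" "b \<in> Poly_Mapping.keys q"
    using keys_mult[of p q] by blast
  then show "Poly_Mapping.keys t \<subseteq> X"
    using assms Poly_Mapping.keys_add[of a b] unfolding poly_in_def by blast
qed

text \<open>Multiplication by \<open>x\<close> shifts every exponent function by the same amount,
  and this shift is injective. The induction builds \<open>p\<close> up one monomial at a
  time.\<close>

lemma lookup_mult_Var_add:
  fixes p :: "'a::semiring_1 indet_poly"
  shows "Poly_Mapping.lookup (p * Var x) (t + Poly_Mapping.single x 1) = Poly_Mapping.lookup p t"
proof (induction p rule: update_induct)
  case const
  show ?case
    by simp
next
  case (update p s c)
  \<comment> \<open>The monomial \<open>s\<close> is new to \<open>p\<close>, so overwriting its
    coefficient is the same as adding a term.\<close>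
  have "Poly_Mapping.update s c p = p + Poly_Mapping.single s c"
    using update.hyps(1)
    by (intro poly_mapping_eqI) (auto simp: lookup_update lookup_add lookup_single in_keys_iff)
  moreover have "Poly_Mapping.lookup (Poly_Mapping.single s c * Var x) (t + Poly_Mapping.single x 1)
      = Poly_Mapping.lookup (Poly_Mapping.single s c) t"
    by (simp add: Var_def mult_single lookup_single when_def)
  ultimately show ?case
    using update.IH by (simp add: distrib_right lookup_add del: One_nat_def)
qed

text \<open>Every monomial of \<open>p * Var x\<close> is divisible by \<open>x\<close>.\<close>

lemma lookup_mult_Var_eq_0:
  fixes p :: "'a::semiring_1 indet_poly"
  assumes "x \<notin> Poly_Mapping.keys t"
  shows "Poly_Mapping.lookup (p * Var x) t = 0"
proof (rule ccontr)
  assume "Poly_Mapping.lookup (p * Var x) t \<noteq> 0"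
  then have "t \<in> Poly_Mapping.keys (p * Var x)"
    by (simp add: in_keys_iff)
  then obtain a where "t = a + Poly_Mapping.single x 1"
    using keys_mult[of p "Var x"] by (auto simp: Var_def)
  with assms show False
    by (simp add: in_keys_iff lookup_add)
qed

lemma lookup_linear_form:
  fixes p :: "'i \<Rightarrow> 'a::semiring_1 indet_poly"
  assumes "finite I" and "inj_on d I" and "r \<in> I" and "Poly_Mapping.keys t \<subseteq> - d ` I"
  shows "Poly_Mapping.lookup (\<Sum>i\<in>I. p i * Var (d i)) (t + Poly_Mapping.single (d r) 1)
    = Poly_Mapping.lookup (p r) t"
proof -
  have "Poly_Mapping.lookup (p i * Var (d i)) (t + Poly_Mapping.single (d r) 1) = 0"
    if "i \<in> I - {r}" for i
  proof (rule lookup_mult_Var_eq_0)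
    \<comment> \<open>Injectivity keeps \<open>d i\<close> apart from the added factor
      \<open>d r\<close>; the hypothesis on \<open>t\<close> keeps it out of
      \<open>t\<close>.\<close>
    have "d i \<noteq> d r"
      using assms(2,3) that by (auto dest: inj_onD)
    then show "d i \<notin> Poly_Mapping.keys (t + Poly_Mapping.single (d r) 1)"
      using assms(4) that by (auto simp: in_keys_iff lookup_add lookup_single)
  qed
  then have "Poly_Mapping.lookup (\<Sum>i\<in>I - {r}. p i * Var (d i))
      (t + Poly_Mapping.single (d r) 1) = 0"
    unfolding lookup_sum by (rule sum.neutral[OF ballI])
  then show ?thesis
    unfolding sum.remove[OF assms(1,3)] lookup_add lookup_mult_Var_add by simp
qed

text \<open>If no \<open>d i\<close> divides \<open>t\<close>, the coefficient of \<open>t\<close>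
  in \<open>p r\<close> can be read off the form at \<open>t\<close> times \<open>d r\<close>; for
  every other \<open>t\<close> it is 0. Without the restriction on the coefficients, the product of
  \<open>d 1\<close> and \<open>d 2\<close> could be charged to either index.\<close>

lemma linear_form_coeffs_unique:
  fixes p q :: "'i \<Rightarrow> 'a::semiring_1 indet_poly"
  assumes "finite I" and "inj_on d I" and "r \<in> I"
    and p: "poly_in (- d ` I) (p r)" and q: "poly_in (- d ` I) (q r)"
    and eq: "(\<Sum>i\<in>I. p i * Var (d i)) = (\<Sum>i\<in>I. q i * Var (d i))"
  shows "p r = q r"
proof (rule poly_mapping_eqI)
  fix t
  show "Poly_Mapping.lookup (p r) t = Poly_Mapping.lookup (q r) t"
  proof (cases "Poly_Mapping.keys t \<subseteq> - d ` I")
    case True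
    show ?thesis
      using lookup_linear_form[OF assms(1-3) True, of p] lookup_linear_form[OF assms(1-3) True, of q]
      unfolding eq by simp
  next
    case False
    then have "t \<notin> Poly_Mapping.keys (p r)" "t \<notin> Poly_Mapping.keys (q r)"
      using p q unfolding poly_in_def by blast+
    then show ?thesis
      by (simp add: in_keys_iff)
  qed
qed

theorem theorem2:
  fixes m k n R :: nat
    and U V W :: "nat \<Rightarrow> nat \<Rightarrow> nat \<Rightarrow> 'a::real_normed_field"
  assumes "m > 0" and "k > 0" and "n > 0" and "R > 0"
  shows "elementary_program m k n R U V W \<longleftrightarrow>
    (\<Sum>s=1..R.
        (\<Sum>i<m. \<Sum>j<k. Const (U s i j) * Var (A i j))
      * (\<Sum>g<k. \<Sum>h<n. Const (V s g h) * Var (B g h))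
      * (\<Sum>l<m. \<Sum>q<n. Const (W s l q) * Var (D q l))) =
    (\<Sum>i<m. \<Sum>j<k. \<Sum>h<n. Var (A i j) * Var (B j h) * Var (D h i))"
proof -
  define I where "I = {..<m} \<times> {..<n}"
  define d where "d = (\<lambda>(l, q). D q l)"
  define \<alpha> where "\<alpha> s = (\<Sum>i<m. \<Sum>j<k. Const (U s i j) * Var (A i j))" for s
  define \<beta> where "\<beta> s = (\<Sum>g<k. \<Sum>h<n. Const (V s g h) * Var (B g h))" for s
  \<comment> \<open>\<open>P\<close> and \<open>Q\<close> are the right and left sides of the
    program identity at \<open>(l, q)\<close>.\<close>
  define P where "P = (\<lambda>(l, q). \<Sum>s=1..R. Const (W s l q) * \<alpha> s * \<beta> s)"
  define Q :: "nat \<times> nat \<Rightarrow> 'a indet_poly"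
    where "Q = (\<lambda>(l, q). \<Sum>g<k. Var (A l g) * Var (B g q))"
  have program: "elementary_program m k n R U V W \<longleftrightarrow> (\<forall>r\<in>I. Q r = P r)"
    by (auto simp: elementary_program_def I_def P_def Q_def \<alpha>_def \<beta>_def)
  have lhs: "(\<Sum>s=1..R. \<alpha> s * \<beta> s * (\<Sum>l<m. \<Sum>q<n. Const (W s l q) * Var (D q l)))
      = (\<Sum>r\<in>I. P r * Var (d r))"
  proof -
    have "(\<Sum>s=1..R. \<alpha> s * \<beta> s * (\<Sum>l<m. \<Sum>q<n. Const (W s l q) * Var (D q l)))
        = (\<Sum>s=1..R. \<Sum>r\<in>I. (case r of (l, q) \<Rightarrow> Const (W s l q) * \<alpha> s * \<beta> s) * Var (d r))"
      unfolding I_def sum.cartesian_product[of _ "{..<n}" "{..<m}"]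
      by (simp add: d_def sum_distrib_left case_prod_unfold ac_simps)
    \<comment> \<open>Exchanging the sums collects, for each \<open>r\<close>, the contributions of
      all \<open>s\<close> into \<open>P r\<close>.\<close>
    also have "\<dots> = (\<Sum>r\<in>I. P r * Var (d r))"
      by (subst sum.swap) (simp add: P_def sum_distrib_right case_prod_unfold)
    finally show ?thesis .
  qed
  have rhs: "(\<Sum>i<m. \<Sum>j<k. \<Sum>h<n. Var (A i j) * Var (B j h) * Var (D h i))
      = (\<Sum>r\<in>I. Q r * Var (d r))"
  proof -
    \<comment> \<open>With the sum over \<open>j\<close> innermost, \<open>i\<close> and
      \<open>h\<close> take the roles of \<open>l\<close> and \<open>q\<close>, and the inner sum is
      \<open>Q (i, h)\<close> times \<open>D h i\<close>.\<close>
    have "(\<Sum>i<m. \<Sum>j<k. \<Sum>h<n. Var (A i j) * Var (B j h) * Var (D h i))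
        = (\<Sum>i<m. \<Sum>h<n. \<Sum>j<k. (Var (A i j) * Var (B j h) * Var (D h i) :: 'a indet_poly))"
      by (intro sum.cong refl sum.swap)
    also have "\<dots> = (\<Sum>r\<in>I. Q r * Var (d r))"
      unfolding I_def sum.cartesian_product[of _ "{..<n}" "{..<m}"]
      by (simp add: Q_def d_def sum_distrib_right case_prod_unfold)
    finally show ?thesis .
  qed
  have coeffs: "P r = Q r" if "r \<in> I" and "(\<Sum>r\<in>I. P r * Var (d r)) = (\<Sum>r\<in>I. Q r * Var (d r))" for r
  proof (rule linear_form_coeffs_unique[OF _ _ that(1) _ _ that(2)])
    show "finite I"
      by (simp add: I_def)
    show "inj_on d I"
      by (auto simp: d_def inj_on_def)
    \<comment> \<open>Only constants and indeterminates of the forms \<open>A\<close> and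
      \<open>B\<close> occur here, and these differ from every \<open>D q l\<close>.\<close>
    show "poly_in (- d ` I) (P r)"
      unfolding P_def \<alpha>_def \<beta>_def case_prod_unfold
      by (intro poly_in_sum poly_in_mult poly_in_Const poly_in_Var) (auto simp: d_def)
    show "poly_in (- d ` I) (Q r)"
      unfolding Q_def case_prod_unfold
      by (intro poly_in_sum poly_in_mult poly_in_Var) (auto simp: d_def)
  qed
  have "(\<forall>r\<in>I. Q r = P r)
      \<longleftrightarrow> (\<Sum>r\<in>I. P r * Var (d r)) = (\<Sum>r\<in>I. Q r * Var (d r))"
  proof (intro iffI ballI)
    assume "\<forall>r\<in>I. Q r = P r"
    then show "(\<Sum>r\<in>I. P r * Var (d r)) = (\<Sum>r\<in>I. Q r * Var (d r))"
      by simp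
  next
    fix r assume "(\<Sum>r\<in>I. P r * Var (d r)) = (\<Sum>r\<in>I. Q r * Var (d r))" and "r \<in> I"
    then show "Q r = P r"
      using coeffs by simp
  qed
  then show ?thesis
    unfolding program lhs[unfolded \<alpha>_def \<beta>_def] rhs .
qed

end
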